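(* Let $\widehat{X}$ be a sandpile graph whose sink has no outgoing edges. If $\mathcal{S}(0)=\{\text{sink}\}$, then $G_0=\{0\}$. Otherwise, $G_0$ is equal to the sandpile group of $\mathcal{S}(0)$, viewed as a subgroup of $\mathcal{M}(\widehat{X})$ via the natural inclusion.
   Context: A sandpile graph $\widehat{X}$ is a finite weakly connected directed multigraph (loops and multiple edges allowed) with a distinguished vertex, the sink, reachable by a directed path from every vertex; the set $V$ of non-sink vertices is nonempty, and $X$ is the digraph obtained by deleting the sink (with edge set $E$). A configuration assigns a nonnegative integer number of grains to each non-sink vertex; it is stable if every $v$ holds fewer than $\deg^{+}(v)$ (out-degree) grains. Toppling an unstable vertex sends one grain along each of its out-edges (grains at the sink vanish; the sink never topples); every configuration has a unique stabilization. $\mathcal{M}(\widehat X)$ is the set of stable configurations with $a\oplus b$ = stabilization of $a+b$, a commutative monoid with identity $0$ (the empty configuration); the sandpile group is its minimal ideal (a group, consisting of the recurrent elements, i.e., those accessible from every element, where $a$ is accessible from $b$ if $b\oplus x=a$ for some $x$). For an idempotent $e$, $G_e$ is the unique maximal subgroup of $\mathcal M(\widehat X)$ with identity $e$. The support $\operatorname{supp}(m)$ is the set of vertices holding at least one grain. A cycle is a directed closed path of length $\ge1$ in $X$. For $W\subseteq V$, $\operatorname{cl}(W)$ is the set of $z\in V$ reachable by a directed path (possibly trivial) in $X$ from some $w\in W$. A set $W\subseteq V$ is strongly connected if each of its vertices reaches every other by a path in $X$; a strongly connected component is a maximal such set; it is cyclic if it contains a cycle. A vertex is acyclic if it lies on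 no cycle. For an idempotent $e$, $A(e)$ is the set of acyclic vertices $v\in V$ with $v\notin\operatorname{cl}(\operatorname{supp}(e))$ such that every cyclic strongly connected component reachable from $v$ by a path in $X$ intersects $\operatorname{supp}(e)$. $\mathcal{S}(e)$ is the subgraph of $\widehat X$ induced on $\operatorname{cl}(\operatorname{supp}(e))\cup A(e)\cup\{\text{sink}\}$ (with sink the same sink), whose edges are those of $\widehat X$ with tail in this vertex set. Sandpile configurations on such a subgraph are identified with configurations of $\widehat X$ that vanish outside its non-sink vertices (the natural inclusion), making its sandpile monoid and group subsets of $\mathcal M(\widehat X)$. *)

theory Defs
  imports "HOL-Algebra.Group" "Graph_Theory.Arc_Walk" "Graph_Theory.Digraph_Component"
begin

definition sandpile_graph :: "('v, 'e) pre_digraph \<Rightarrow> 'v \<Rightarrow> bool" where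
  "sandpile_graph G s \<longleftrightarrow>
     fin_digraph G \<and> connected G \<and> s \<in> verts G \<and> verts G - {s} \<noteq> {} \<and>
     (\<forall>v\<in>verts G. v \<rightarrow>\<^sup>*\<^bsub>G\<^esub> s)"

text \<open>A configuration is a function on the whole vertex type that vanishes off the non-sink
  vertices. Hence, for a subgraph with the same sink, the natural inclusion of configurations
  (extension by zero) is the identity on functions.\<close>

definition config :: "('v, 'e) pre_digraph \<Rightarrow> 'v \<Rightarrow> ('v \<Rightarrow> nat) \<Rightarrow> bool" where
  "config G s c \<longleftrightarrow> (\<forall>v. v \<notin> verts G - {s} \<longrightarrow> c v = 0)"

definition stable :: "('v, 'e) pre_digraph \<Rightarrow> 'v \<Rightarrow> ('v \<Rightarrow> nat) \<Rightarrow> bool" where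
  "stable G s c \<longleftrightarrow> config G s c \<and> (\<forall>v\<in>verts G - {s}. c v < out_degree G v)"

definition topple :: "('v, 'e) pre_digraph \<Rightarrow> 'v \<Rightarrow> 'v \<Rightarrow> ('v \<Rightarrow> nat) \<Rightarrow> 'v \<Rightarrow> nat" where
  "topple G s v c = (\<lambda>w. if w \<in> verts G - {s}
     then c w - (if w = v then out_degree G v else 0) + card (out_arcs G v \<inter> in_arcs G w)
     else 0)"

definition topples :: "('v, 'e) pre_digraph \<Rightarrow> 'v \<Rightarrow> ('v \<Rightarrow> nat) \<Rightarrow> ('v \<Rightarrow> nat) \<Rightarrow> bool" where
  "topples G s c c' \<longleftrightarrow> (\<exists>v\<in>verts G - {s}. out_degree G v \<le> c v \<and> c' = topple G s v c)"

definition stabilization :: "('v, 'e) pre_digraph \<Rightarrow> 'v \<Rightarrow> ('v \<Rightarrow> nat) \<Rightarrow> 'v \<Rightarrow> nat" where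
  "stabilization G s c = (THE c'. (topples G s)\<^sup>*\<^sup>* c c' \<and> stable G s c')"

definition sandpile_monoid :: "('v, 'e) pre_digraph \<Rightarrow> 'v \<Rightarrow> ('v \<Rightarrow> nat) monoid" where
  "sandpile_monoid G s =
     \<lparr> carrier = {c. stable G s c},
       monoid.mult = (\<lambda>a b. stabilization G s (\<lambda>v. a v + b v)),
       one = (\<lambda>_. 0) \<rparr>"

definition monoid_ideal :: "('a, 'b) monoid_scheme \<Rightarrow> 'a set \<Rightarrow> bool" where
  "monoid_ideal M I \<longleftrightarrow> I \<noteq> {} \<and> I \<subseteq> carrier M \<and>
     (\<forall>x\<in>I. \<forall>a\<in>carrier M. a \<otimes>\<^bsub>M\<^esub> x \<in> I \<and> x \<otimes>\<^bsub>M\<^esub> a \<in> I)"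

definition minimal_ideal :: "('a, 'b) monoid_scheme \<Rightarrow> 'a set" where
  "minimal_ideal M =
     (THE I. monoid_ideal M I \<and> (\<forall>J. monoid_ideal M J \<and> J \<subseteq> I \<longrightarrow> J = I))"

definition sandpile_group :: "('v, 'e) pre_digraph \<Rightarrow> 'v \<Rightarrow> ('v \<Rightarrow> nat) set" where
  "sandpile_group G s = minimal_ideal (sandpile_monoid G s)"

text \<open>Subgroups of a monoid in the sense of semigroup theory: the identity \<open>e\<close> may be any
  idempotent of \<open>M\<close>.\<close>

definition subgroup_at :: "('a, 'b) monoid_scheme \<Rightarrow> 'a \<Rightarrow> 'a set \<Rightarrow> bool" where
  "subgroup_at M e H \<longleftrightarrow> H \<subseteq> carrier M \<and> group (M\<lparr>carrier := H, one := e\<rparr>)"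

definition maximal_subgroup :: "('a, 'b) monoid_scheme \<Rightarrow> 'a \<Rightarrow> 'a set" where
  "maximal_subgroup M e =
     (THE H. subgroup_at M e H \<and> (\<forall>K. subgroup_at M e K \<and> H \<subseteq> K \<longrightarrow> K = H))"

text \<open>The vertices of a closed walk are exactly the tails of its arcs. A loop is a cycle.\<close>

definition is_cycle :: "('v, 'e) pre_digraph \<Rightarrow> 'e list \<Rightarrow> bool" where
  "is_cycle X p \<longleftrightarrow> p \<noteq> [] \<and> (\<exists>u. pre_digraph.awalk X u p u)"

definition acyclic_vertex :: "('v, 'e) pre_digraph \<Rightarrow> 'v \<Rightarrow> bool" where
  "acyclic_vertex X v \<longleftrightarrow> v \<in> verts X \<and> \<not> (\<exists>p. is_cycle X p \<and> v \<in> tail X ` set p)"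

definition strongly_connected_set :: "('v, 'e) pre_digraph \<Rightarrow> 'v set \<Rightarrow> bool" where
  "strongly_connected_set X W \<longleftrightarrow> W \<subseteq> verts X \<and> (\<forall>u\<in>W. \<forall>v\<in>W. u \<rightarrow>\<^sup>*\<^bsub>X\<^esub> v)"

definition strong_component :: "('v, 'e) pre_digraph \<Rightarrow> 'v set \<Rightarrow> bool" where
  "strong_component X W \<longleftrightarrow> strongly_connected_set X W \<and>
     (\<forall>W'. strongly_connected_set X W' \<and> W \<subseteq> W' \<longrightarrow> W' = W)"

definition cyclic_set :: "('v, 'e) pre_digraph \<Rightarrow> 'v set \<Rightarrow> bool" where
  "cyclic_set X W \<longleftrightarrow> (\<exists>p. is_cycle X p \<and> tail X ` set p \<subseteq> W)"

definition cl :: "('v, 'e) pre_digraph \<Rightarrow> 'v set \<Rightarrow> 'v set" where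
  "cl X W = {z \<in> verts X. \<exists>w\<in>W. w \<rightarrow>\<^sup>*\<^bsub>X\<^esub> z}"

definition supp :: "('v \<Rightarrow> nat) \<Rightarrow> 'v set" where
  "supp m = {v. m v \<ge> 1}"

definition A_set :: "('v, 'e) pre_digraph \<Rightarrow> ('v \<Rightarrow> nat) \<Rightarrow> 'v set" where
  "A_set X e = {v \<in> verts X. acyclic_vertex X v \<and> v \<notin> cl X (supp e) \<and>
     (\<forall>W. strong_component X W \<and> cyclic_set X W \<and> (\<exists>w\<in>W. v \<rightarrow>\<^sup>*\<^bsub>X\<^esub> w) \<longrightarrow> W \<inter> supp e \<noteq> {})}"

definition S_verts :: "('v, 'e) pre_digraph \<Rightarrow> 'v \<Rightarrow> ('v \<Rightarrow> nat) \<Rightarrow> 'v set" where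
  "S_verts G s e =
     (let X = pre_digraph.del_vert G s in cl X (supp e) \<union> A_set X e \<union> {s})"

definition S_graph :: "('v, 'e) pre_digraph \<Rightarrow> 'v \<Rightarrow> ('v \<Rightarrow> nat) \<Rightarrow> ('v, 'e) pre_digraph" where
  "S_graph G s e = G \<restriction> S_verts G s e"

text \<open>If the sink has no outgoing edges, the heads of the edges leaving the vertex set lie in it
  again, so the induced subgraph keeps every edge with tail in the set, and stabilization in the
  subgraph agrees with stabilization in the whole graph.\<close>

lemma S_verts_closed:
  assumes wf: "wf_digraph G" and sink: "out_arcs G s = {}"
    and a: "a \<in> arcs G" "tail G a \<in> S_verts G s e"
  shows "head G a \<in> S_verts G s e"
proof (cases "head G a = s")
  case True
  then show ?thesis by (simp add: S_verts_def Let_def)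
next
  case False
  interpret G: wf_digraph G by (fact wf)
  define X where "X = pre_digraph.del_vert G s"
  interpret X: wf_digraph X unfolding X_def by (rule G.wf_digraph_del_vert)
  let ?t = "tail G a" and ?h = "head G a"
  have t: "?t \<noteq> s" using sink a by (auto simp: out_arcs_def)
  have aX: "a \<in> arcs X" "tail X a = ?t" "head X a = ?h"
    using a t False by (auto simp: X_def G.del_vert_simps)
  then have th: "?t \<rightarrow>\<^bsub>X\<^esub> ?h" by (metis X.dominatesI arc_to_ends_def)
  have hX: "?h \<in> verts X" using th X.adj_in_verts by blast
  have "?t \<in> cl X (supp e) \<union> A_set X e" using a t by (simp add: S_verts_def X_def Let_def)
  then have "?h \<in> cl X (supp e) \<union> A_set X e"
  proof
    assume "?t \<in> cl X (supp e)"
    then show ?thesis using th hX by (auto simp: cl_def intro: X.reachable_adj_trans)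
  next
    assume A: "?t \<in> A_set X e"
    have reach: "W \<inter> supp e \<noteq> {}"
      if "strong_component X W" "cyclic_set X W" "w \<in> W" "?h \<rightarrow>\<^sup>*\<^bsub>X\<^esub> w" for W w
      using A that th X.adj_reachable_trans[of ?t ?h w] unfolding A_set_def by blast
    show ?thesis
    proof (cases "acyclic_vertex X ?h")
      case True
      then show ?thesis using reach hX by (auto simp: A_set_def)
    next
      case False
      then obtain p where p: "is_cycle X p" "?h \<in> tail X ` set p"
        using hX by (auto simp: acyclic_vertex_def)
      then obtain u where u: "X.awalk u p u" by (auto simp: is_cycle_def)
      define W where "W = {v. ?h \<rightarrow>\<^sup>*\<^bsub>X\<^esub> v \<and> v \<rightarrow>\<^sup>*\<^bsub>X\<^esub> ?h}"
      have hW: "?h \<in> W" using hX by (simp add: W_def)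
      have "strongly_connected_set X W"
        unfolding strongly_connected_set_def W_def
        using X.reachable_trans X.reachable_in_verts(2) by blast
      moreover have "W' = W" if "strongly_connected_set X W'" "W \<subseteq> W'" for W'
        using that hW unfolding strongly_connected_set_def W_def by blast
      ultimately have "strong_component X W" unfolding strong_component_def by blast
      moreover have "cyclic_set X W"
      proof -
        have vs: "w \<in> set (X.awalk_verts u p)" if "w \<in> tail X ` set p" for w
          using that by (auto simp: X.awalk_verts_conv)
        have "w \<rightarrow>\<^sup>*\<^bsub>X\<^esub> w'" if "w \<in> tail X ` set p" "w' \<in> tail X ` set p" for w w'
          using X.awalk_verts_reachable_to[OF u vs[OF that(1)]]
            X.awalk_verts_reachable_from[OF u vs[OF that(2)]] X.reachable_trans by blast
        then have "tail X ` set p \<subseteq> W" using p(2) unfolding W_def by blast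
        then show ?thesis using p(1) unfolding cyclic_set_def by blast
      qed
      ultimately obtain v where v: "v \<in> W" "v \<in> supp e" using reach hW W_def by blast
      then show ?thesis using hX by (auto simp: cl_def W_def)
    qed
  qed
  then show ?thesis by (simp add: S_verts_def X_def Let_def)
qed

lemma arcs_S_graph:
  assumes "wf_digraph G" "out_arcs G s = {}"
  shows "arcs (S_graph G s e) = {a \<in> arcs G. tail G a \<in> S_verts G s e}"
  using S_verts_closed[OF assms] by (auto simp: S_graph_def)

lemma S_verts_subset: "s \<in> verts G \<Longrightarrow> S_verts G s e \<subseteq> verts G"
  by (auto simp: S_verts_def Let_def cl_def A_set_def pre_digraph.del_vert_def)

lemma config_topple: "config G s (topple G s v c)"
  by (auto simp: config_def topple_def)

lemma out_degree_pos:
  assumes "sandpile_graph G s" "v \<in> verts G - {s}"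
  shows "0 < out_degree G v"
proof -
  interpret fin_digraph G using assms by (simp add: sandpile_graph_def)
  have "v \<rightarrow>\<^sup>*\<^bsub>G\<^esub> s" "v \<noteq> s" using assms by (auto simp: sandpile_graph_def)
  then obtain w where "v \<rightarrow>\<^bsub>G\<^esub> w" by (blast elim: converse_reachable_cases)
  then obtain a where "a \<in> out_arcs G v" by auto
  then show ?thesis unfolding out_degree_def using finite_out_arcs by (auto simp: card_gt_0_iff)
qed

lemma stabilization_S_graph:
  assumes G: "sandpile_graph G s" and sink: "out_arcs G s = {}" and c: "config (S_graph G s e) s c"
  shows "stabilization (S_graph G s e) s c = stabilization G s c"
proof -
  interpret fin_digraph G using G by (simp add: sandpile_graph_def)
  let ?S = "S_graph G s e"
  have sG: "s \<in> verts G" using G by (simp add: sandpile_graph_def)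
  have vS: "verts ?S \<subseteq> verts G" using S_verts_subset[OF sG] by (simp add: S_graph_def)
  have th: "tail ?S = tail G" "head ?S = head G" by (simp_all add: S_graph_def)
  have arcs: "arcs ?S = {a \<in> arcs G. tail G a \<in> verts ?S}"
    using arcs_S_graph[OF wf_digraph sink] by (simp add: S_graph_def)
  have closed: "head G a \<in> verts ?S" if "a \<in> arcs G" "tail G a \<in> verts ?S" for a
    using S_verts_closed[OF wf_digraph sink] that by (simp add: S_graph_def)
  have out: "out_arcs ?S v = out_arcs G v" if "v \<in> verts ?S" for v
    using that th arcs by (auto simp: out_arcs_def)
  have deg: "out_degree ?S v = out_degree G v" if "v \<in> verts ?S" for v
    using out[OF that] by (simp add: out_degree_def)
  have btw: "out_arcs ?S v \<inter> in_arcs ?S w = out_arcs G v \<inter> in_arcs G w" if "v \<in> verts ?S" for v w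
    using that th arcs by (auto simp: out_arcs_def in_arcs_def)
  have top: "topple ?S s v d = topple G s v d" if "v \<in> verts ?S" "config ?S s d" for v d
  proof
    fix w
    show "topple ?S s v d w = topple G s v d w"
    proof (cases "w \<in> verts ?S - {s}")
      case True
      then show ?thesis using vS that(1) deg btw by (auto simp: topple_def)
    next
      case False
      have "out_arcs G v \<inter> in_arcs G w = {}" if "w \<noteq> s"
        using False that closed \<open>v \<in> verts ?S\<close> by auto
      then show ?thesis using False that by (auto simp: topple_def config_def)
    qed
  qed
  have eq: "topples ?S s d d' \<longleftrightarrow> topples G s d d'" if d: "config ?S s d" for d d'
  proof
    assume "topples ?S s d d'"
    then obtain v where v: "v \<in> verts ?S - {s}" "out_degree ?S v \<le> d v" "d' = topple ?S s v d"
      by (auto simp: topples_def)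
    then have "v \<in> verts G - {s}" "out_degree G v \<le> d v" "d' = topple G s v d"
      using vS deg top d by auto
    then show "topples G s d d'" unfolding topples_def by blast
  next
    assume "topples G s d d'"
    then obtain v where v: "v \<in> verts G - {s}" "out_degree G v \<le> d v" "d' = topple G s v d"
      by (auto simp: topples_def)
    then have "d v \<noteq> 0" using out_degree_pos[OF G v(1)] by simp
    then have vs: "v \<in> verts ?S - {s}" using d unfolding config_def by metis
    then have "out_degree ?S v \<le> d v" "d' = topple ?S s v d" using v deg top d by auto
    with vs show "topples ?S s d d'" unfolding topples_def by blast
  qed
  have conf: "config ?S s d'" if "topples ?S s d d'" for d d'
    using that by (auto simp: topples_def config_topple)
  have steps1: "(topples G s)\<^sup>*\<^sup>* c d \<and> config ?S s d" if "(topples ?S s)\<^sup>*\<^sup>* c d" for d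
    using that
  proof induction
    case base
    then show ?case using c by simp
  next
    case (step d d')
    then show ?case using eq[of d d'] conf[of d d'] by (auto intro: rtranclp.rtrancl_into_rtrancl)
  qed
  have steps2: "(topples ?S s)\<^sup>*\<^sup>* c d \<and> config ?S s d" if "(topples G s)\<^sup>*\<^sup>* c d" for d
    using that
  proof induction
    case base
    then show ?case using c by simp
  next
    case (step d d')
    then show ?case using eq[of d d'] conf[of d d'] by (auto intro: rtranclp.rtrancl_into_rtrancl)
  qed
  have stab: "stable ?S s d \<longleftrightarrow> stable G s d" if "config ?S s d" for d
  proof -
    have confG: "config G s d" using that vS by (auto simp: config_def)
    have outside: "d v < out_degree G v" if "v \<in> verts G - {s}" "v \<notin> verts ?S" for v
      using out_degree_pos[OF G that(1)] \<open>config ?S s d\<close> that by (simp add: config_def)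
    have "(\<forall>v\<in>verts ?S - {s}. d v < out_degree ?S v) \<longleftrightarrow>
        (\<forall>v\<in>verts G - {s}. d v < out_degree G v)" (is "?l \<longleftrightarrow> ?r")
    proof
      assume l: ?l
      show ?r
      proof
        fix v assume v: "v \<in> verts G - {s}"
        show "d v < out_degree G v"
        proof (cases "v \<in> verts ?S")
          case True
          then have "d v < out_degree ?S v" using l v by blast
          then show ?thesis using deg[OF True] by simp
        qed (rule outside[OF v])
      qed
    next
      assume r: ?r
      show ?l
      proof
        fix v assume "v \<in> verts ?S - {s}"
        then show "d v < out_degree ?S v" using r vS deg[of v] by auto
      qed
    qed
    then show ?thesis using that confG by (simp add: stable_def)
  qed
  have "((topples ?S s)\<^sup>*\<^sup>* c d \<and> stable ?S s d) = ((topples G s)\<^sup>*\<^sup>* c d \<and> stable G s d)" for d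
    using steps1[of d] steps2[of d] stab[of d] by auto
  then show ?thesis by (simp add: stabilization_def)
qed

end

theory Submission
  imports Defs "HOL-Library.Confluence"
begin

text \<open>
  The group \<open>G\<^sub>0\<close> consists of the units of the sandpile monoid, and a non-sink vertex lies in
  \<open>\<S>(0)\<close> iff it reaches no cycle. A vertex that does reach a cycle has an out-neighbour of the
  same kind, so toppling never clears the set of these vertices: a unit cannot charge any of them.
  Conversely, a vertex \<open>v\<close> of \<open>\<S>(0)\<close> charged with \<open>deg\<^sup>+(v)\<close> grains topples to a configuration
  on its out-neighbours; by well-founded induction that configuration divides \<open>0\<close>, hence so does a
  single grain at \<open>v\<close>. So the units are exactly the stable configurations of \<open>\<S>(0)\<close>; these form
  a group, and a group is its own minimal ideal.
\<close>

definition grain :: "'v \<Rightarrow> 'v \<Rightarrow> nat" where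
  "grain v = (\<lambda>w. if w = v then 1 else 0)"

section \<open>Cycles and acyclic vertices in terms of reachability\<close>

text \<open>Rotating the closed walk so that it starts with an arc leaving \<open>x\<close> gives a
  nonempty closed walk at \<open>x\<close>.\<close>

lemma (in wf_digraph) cycle_reachable1:
  assumes "is_cycle G p" "x \<in> tail G ` set p"
  shows "x \<rightarrow>\<^sup>+ x"
proof -
  obtain u where u: "awalk u p u" using assms(1) by (auto simp: is_cycle_def)
  obtain a where a: "a \<in> set p" "x = tail G a" using assms(2) by blast
  then obtain q r where "p = q @ a # r" by (auto simp: in_set_conv_decomp)
  then have "awalk x (a # r) u" "awalk u q x" using u a by (auto simp: awalk_Cons_iff)
  then have "awalk x ((a # r) @ q) x" by (rule awalk_appendI)
  then show ?thesis unfolding reachable1_awalk by blast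
qed

lemma (in wf_digraph) acyclic_vertex_not_reachable1:
  assumes "acyclic_vertex G v"
  shows "\<not> v \<rightarrow>\<^sup>+ v"
proof
  assume "v \<rightarrow>\<^sup>+ v"
  then obtain p where p: "awalk v p v" "p \<noteq> []" unfolding reachable1_awalk by blast
  then have "v = tail G (hd p)" by (cases p) (auto simp: awalk_Cons_iff)
  then have "v \<in> tail G ` set p" using p(2) by simp
  then show False using assms p by (auto simp: acyclic_vertex_def is_cycle_def)
qed

text \<open>The zero configuration has empty support, so \<open>A_set\<close> here consists of the
  acyclic vertices that reach no cyclic component. If either condition fails, a vertex on a cycle is
  reachable.\<close>

lemma (in wf_digraph) reaches_cycle_if_not_in_A_set:
  assumes "v \<in> verts G" "v \<notin> A_set G (\<lambda>_. 0)"
  shows "\<exists>x. v \<rightarrow>\<^sup>* x \<and> x \<rightarrow>\<^sup>+ x"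
proof (cases "acyclic_vertex G v")
  case False
  then show ?thesis using cycle_reachable1 assms(1) by (auto simp: acyclic_vertex_def)
next
  case True
  then obtain W w where W: "strong_component G W" "cyclic_set G W" "w \<in> W" "v \<rightarrow>\<^sup>* w"
    using assms by (auto simp: A_set_def cl_def supp_def)
  then obtain p where p: "is_cycle G p" "tail G ` set p \<subseteq> W" by (auto simp: cyclic_set_def)
  then have "hd p \<in> set p" by (simp add: is_cycle_def)
  then have "tail G (hd p) \<rightarrow>\<^sup>+ tail G (hd p)" "tail G (hd p) \<in> W"
    using cycle_reachable1[OF p(1)] p(2) by auto
  moreover from this have "v \<rightarrow>\<^sup>* tail G (hd p)"
    using W reachable_trans by (auto simp: strong_component_def strongly_connected_set_def)
  ultimately show ?thesis by blast
qed

section \<open>Toppling sequences and confluence\<close>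

locale sandpile = fin_digraph G for G :: "('v, 'e) pre_digraph" (structure) +
  fixes s :: 'v
  assumes sandpile_graph: "sandpile_graph G s"
begin

lemma out_degree_pos: "v \<in> verts G - {s} \<Longrightarrow> 0 < out_degree G v"
  by (rule Defs.out_degree_pos[OF sandpile_graph])

lemma config_add: "config G s c \<Longrightarrow> config G s d \<Longrightarrow> config G s (\<lambda>v. c v + d v)"
  by (simp add: config_def)

lemma stable_config: "stable G s c \<Longrightarrow> config G s c"
  by (simp add: stable_def)

lemma stable_zero: "stable G s (\<lambda>_. 0)"
  using out_degree_pos by (simp add: stable_def config_def)

lemma topples_config: "topples G s c c' \<Longrightarrow> config G s c'"
  by (auto simp: topples_def config_topple)

lemma stable_not_topples: "stable G s c \<Longrightarrow> \<not> topples G s c c'"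
  by (auto simp: stable_def topples_def not_le[symmetric])

lemma topples_rtranclp_stable: "(topples G s)\<^sup>*\<^sup>* c d \<Longrightarrow> stable G s c \<Longrightarrow> d = c"
  by (erule converse_rtranclpE) (auto dest: stable_not_topples)

text \<open>A vertex that may topple holds at least its out-degree, so the truncated subtraction is
  exact and extra grains pass through unchanged. They must form a configuration because
  \<open>topple\<close> resets all values off the non-sink vertices to 0.\<close>

lemma topples_add:
  assumes "topples G s c c'" "config G s d"
  shows "topples G s (\<lambda>v. c v + d v) (\<lambda>v. c' v + d v)"
proof -
  obtain v where v: "v \<in> verts G - {s}" "out_degree G v \<le> c v" "c' = topple G s v c"
    using assms(1) by (auto simp: topples_def)
  have "(\<lambda>w. c' w + d w) = topple G s v (\<lambda>w. c w + d w)"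
    using v assms(2) by (auto simp: fun_eq_iff topple_def config_def)
  then show ?thesis using v unfolding topples_def by (intro bexI[of _ v]) auto
qed

lemma topples_rtranclp_add:
  assumes "(topples G s)\<^sup>*\<^sup>* c c'" "config G s d"
  shows "(topples G s)\<^sup>*\<^sup>* (\<lambda>v. c v + d v) (\<lambda>v. c' v + d v)"
  using assms(1)
  by induction (auto intro: rtranclp.rtrancl_into_rtrancl topples_add[OF _ assms(2)])

text \<open>Toppling \<open>v\<close> takes grains from \<open>v\<close> only, so another unstable
  vertex \<open>w\<close> remains unstable; the two topplings commute and close the diamond in one
  step on each side.\<close>

lemma confluentp_topples: "confluentp (topples G s)"
proof (rule strong_confluentp_imp_confluentp, rule strong_confluentpI)
  fix c c1 c2
  assume "topples G s c c1" "topples G s c c2"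
  then obtain v w where
    v: "v \<in> verts G - {s}" "out_degree G v \<le> c v" "c1 = topple G s v c" and
    w: "w \<in> verts G - {s}" "out_degree G w \<le> c w" "c2 = topple G s w c"
    by (auto simp: topples_def)
  show "\<exists>u. (topples G s)\<^sup>*\<^sup>* c1 u \<and> (topples G s)\<^sup>=\<^sup>= c2 u"
  proof (cases "v = w")
    case True
    then show ?thesis using v w by auto
  next
    case False
    have "topple G s w c1 = topple G s v c2"
      using False v w by (auto simp: fun_eq_iff topple_def)
    moreover have "out_degree G w \<le> c1 w" "out_degree G v \<le> c2 v"
      using False v w by (auto simp: topple_def)
    ultimately have "topples G s c1 (topple G s w c1)" "topples G s c2 (topple G s w c1)"
      using v(1) w(1) unfolding topples_def by auto
    then show ?thesis by blast
  qed
qed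

lemma stabilization_unique:
  assumes "(topples G s)\<^sup>*\<^sup>* c d" "stable G s d"
  shows "stabilization G s c = d"
  unfolding stabilization_def
proof (rule the_equality)
  fix d' assume "(topples G s)\<^sup>*\<^sup>* c d' \<and> stable G s d'"
  then show "d' = d"
    using confluentpD[OF confluentp_topples assms(1)] assms(2) topples_rtranclp_stable by metis
qed (use assms in simp)

section \<open>Termination of toppling by a weighted potential\<close>

text \<open>Only an inequality holds, since grains sent to the sink leave the sum on the left while
  their arcs are still counted on the right.\<close>

lemma sum_topple_le:
  fixes h :: "'v \<Rightarrow> int"
  assumes v: "v \<in> verts G - {s}" "out_degree G v \<le> c v" and h: "\<And>w. 0 \<le> h w"
  shows "(\<Sum>w\<in>verts G - {s}. h w * int (topple G s v c w)) \<le>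
    (\<Sum>w\<in>verts G - {s}. h w * int (c w)) - h v * int (out_degree G v) +
    (\<Sum>a\<in>out_arcs G v. h (head G a))"
proof -
  let ?V = "verts G - {s}"
  let ?k = "\<lambda>w. card (out_arcs G v \<inter> in_arcs G w)"
  have eq: "h w * int (topple G s v c w) =
      h w * int (c w) - (if w = v then h v * int (out_degree G v) else 0) + h w * int (?k w)"
    if "w \<in> ?V" for w
    using that v(2) by (auto simp: topple_def algebra_simps of_nat_diff)
  have arcs: "{a \<in> out_arcs G v. head G a = w} = out_arcs G v \<inter> in_arcs G w" for w
    by auto
  \<comment> \<open>Adding the nonnegative sink term lets the arcs out of \<open>v\<close> be
    grouped by their heads.\<close>
  have "(\<Sum>w\<in>?V. h w * int (?k w)) \<le> (\<Sum>w\<in>verts G. h w * int (?k w))"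
    by (rule sum_mono2) (use h in auto)
  also have "\<dots> = (\<Sum>w\<in>verts G. \<Sum>a\<in>{a \<in> out_arcs G v. head G a = w}. h (head G a))"
    by (rule sum.cong) (auto simp flip: arcs)
  also have "\<dots> = (\<Sum>a\<in>out_arcs G v. h (head G a))"
    by (rule sum.group) auto
  finally show ?thesis
    using v(1) by (simp add: eq sum.distrib sum_subtractf)
qed

text \<open>
  Put \<open>g w = K ^ (D - d w)\<close>, where \<open>d w\<close> is the distance from \<open>w\<close> to the sink, \<open>D\<close> bounds all
  distances and \<open>K\<close> exceeds all out-degrees. Some out-neighbour of \<open>v\<close> is closer to the sink than
  \<open>v\<close>, so already its share exceeds \<open>deg\<^sup>+(v) * g v\<close>.
\<close>

lemma ex_increasing_weight:
  obtains g :: "'v \<Rightarrow> int" and M :: int where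
    "\<And>w. 0 \<le> g w" "\<And>w. g w \<le> M"
    "\<And>v. v \<in> verts G - {s} \<Longrightarrow>
      int (out_degree G v) * g v < (\<Sum>a\<in>out_arcs G v. g (head G a))"
proof -
  define d where "d v = (LEAST n. (v, s) \<in> arcs_ends G ^^ n)" for v
  define D where "D = Max (d ` verts G)"
  define K where "K = int (card (arcs G)) + 1"
  define g where "g v = K ^ (D - d v)" for v
  have K: "1 \<le> K" by (simp add: K_def)
  have "0 \<le> g w" for w using K by (simp add: g_def)
  moreover have "g w \<le> K ^ D" for w using K by (simp add: g_def power_increasing)
  moreover have "int (out_degree G v) * g v < (\<Sum>a\<in>out_arcs G v. g (head G a))"
    if v: "v \<in> verts G - {s}" for v
  proof -
    have "v \<rightarrow>\<^sup>* s" using v sandpile_graph by (auto simp: sandpile_graph_def)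
    then have "\<exists>n. (v, s) \<in> arcs_ends G ^^ n"
      using reachable_rtranclI rtrancl_imp_relpow by metis
    then have dv: "(v, s) \<in> arcs_ends G ^^ d v" unfolding d_def by (rule LeastI_ex)
    moreover have "d v \<noteq> 0" using dv v by (metis Diff_iff insertI1 relpow_0_E)
    ultimately obtain n w where n: "d v = Suc n" and w: "v \<rightarrow> w" "(w, s) \<in> arcs_ends G ^^ n"
      by (metis not0_implies_Suc relpow_Suc_E2)
    have "d w \<le> n" unfolding d_def by (rule Least_le) (fact w(2))
    moreover have "d v \<le> D" using v by (simp add: D_def)
    ultimately have le: "Suc (D - d v) \<le> D - d w" using n by simp
    obtain a where a: "a \<in> out_arcs G v" "head G a = w" using w(1) by auto
    have "int (out_degree G v) < K"
      using card_mono[OF finite_arcs, of "out_arcs G v"]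
      by (simp add: K_def out_degree_def out_arcs_def)
    then have "int (out_degree G v) * g v < K * g v"
      using K by (simp add: g_def)
    also have "\<dots> \<le> g w" using power_increasing[OF le K] by (simp add: g_def)
    also have "\<dots> \<le> (\<Sum>a\<in>out_arcs G v. g (head G a))"
      using member_le_sum[OF a(1), of "\<lambda>a. g (head G a)"] a(2) \<open>\<And>w. 0 \<le> g w\<close> finite_out_arcs
      by simp
    finally show ?thesis .
  qed
  ultimately show thesis by (rule that)
qed

text \<open>The potential with weights \<open>M - g w\<close> is a nonnegative integer and drops at
  every toppling, so toppling must stop, and it can stop only at a stable configuration.\<close>

lemma ex_stabilization:
  assumes "config G s c"
  shows "\<exists>d. (topples G s)\<^sup>*\<^sup>* c d \<and> stable G s d"
proof -
  obtain g :: "'v \<Rightarrow> int" and M :: int where g: "\<And>w. 0 \<le> g w" "\<And>w. g w \<le> M"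
    "\<And>v. v \<in> verts G - {s} \<Longrightarrow>
      int (out_degree G v) * g v < (\<Sum>a\<in>out_arcs G v. g (head G a))"
    using ex_increasing_weight by blast
  define f where "f c = (\<Sum>w\<in>verts G - {s}. (M - g w) * int (c w))" for c
  have nonneg: "0 \<le> f c" for c using g(2) by (auto simp: f_def intro!: sum_nonneg)
  have decr: "f c' < f c" if c': "topples G s c c'" for c c'
  proof -
    obtain v where v: "v \<in> verts G - {s}" "out_degree G v \<le> c v" "c' = topple G s v c"
      using c' by (auto simp: topples_def)
    have "f c' \<le> f c - (M - g v) * int (out_degree G v) + (\<Sum>a\<in>out_arcs G v. M - g (head G a))"
      unfolding f_def v(3) by (rule sum_topple_le) (use v g(2) in auto)
    \<comment> \<open>\<open>M\<close> occurs once per out-arc in both terms and cancels; what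
      remains is the strict gain in \<open>g\<close>.\<close>
    also have "\<dots> < f c"
      using g(3)[OF v(1)] by (simp add: sum_subtractf out_degree_def algebra_simps)
    finally show ?thesis .
  qed
  show ?thesis
    using assms
  proof (induction "nat (f c)" arbitrary: c rule: less_induct)
    case less
    show ?case
    proof (cases "stable G s c")
      case False
      then obtain c' where c': "topples G s c c'"
        using less.prems by (auto simp: stable_def topples_def not_less)
      have "nat (f c') < nat (f c)" using decr[OF c'] nonneg[of c'] by linarith
      then show ?thesis
        using less.hyps topples_config[OF c'] c' converse_rtranclp_into_rtranclp by metis
    qed blast
  qed
qed

section \<open>Stabilization as a normal form, and the sandpile monoid\<close>

lemma stabilization:
  assumes "config G s c"
  shows "(topples G s)\<^sup>*\<^sup>* c (stabilization G s c)" "stable G s (stabilization G s c)"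
  using ex_stabilization[OF assms] stabilization_unique by auto

lemma stabilization_stable: "stable G s c \<Longrightarrow> stabilization G s c = c"
  by (rule stabilization_unique) auto

lemma stabilization_topples:
  assumes "config G s d" "(topples G s)\<^sup>*\<^sup>* c d"
  shows "stabilization G s d = stabilization G s c"
  using stabilization[OF assms(1)] assms(2) stabilization_unique[of c]
  by (metis rtranclp_trans)

text \<open>The topplings that stabilize \<open>c\<close> stay legal with \<open>d\<close> on top,
  so stabilizing a summand early does not change the result. Associativity rests on this.\<close>

lemma stabilization_add_stabilization:
  assumes "config G s c" "config G s d"
  shows "stabilization G s (\<lambda>v. stabilization G s c v + d v) = stabilization G s (\<lambda>v. c v + d v)"
  by (intro stabilization_topples topples_rtranclp_add stabilization(1) assms
      config_add stable_config[OF stabilization(2)])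

lemma sandpile_monoid_simps:
  "carrier (sandpile_monoid G s) = {c. stable G s c}"
  "a \<otimes>\<^bsub>sandpile_monoid G s\<^esub> b = stabilization G s (\<lambda>v. a v + b v)"
  "\<one>\<^bsub>sandpile_monoid G s\<^esub> = (\<lambda>_. 0)"
  by (simp_all add: sandpile_monoid_def)

lemma comm_monoid_sandpile_monoid: "comm_monoid (sandpile_monoid G s)"
proof (rule comm_monoidI, unfold sandpile_monoid_simps mem_Collect_eq)
  fix a b c
  assume abc: "stable G s a" "stable G s b" "stable G s c"
  then have "stabilization G s (\<lambda>v. stabilization G s (\<lambda>v. a v + b v) v + c v) =
      stabilization G s (\<lambda>v. a v + b v + c v)"
    by (intro stabilization_add_stabilization config_add stable_config)
  \<comment> \<open>The inner stabilization is kept as the left summand to match the lemma;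
    commutativity of addition restores the order.\<close>
  moreover have "stabilization G s (\<lambda>v. stabilization G s (\<lambda>v. b v + c v) v + a v) =
      stabilization G s (\<lambda>v. b v + c v + a v)"
    using abc by (intro stabilization_add_stabilization config_add stable_config)
  ultimately show "stabilization G s (\<lambda>v. stabilization G s (\<lambda>v. a v + b v) v + c v) =
      stabilization G s (\<lambda>v. a v + stabilization G s (\<lambda>v. b v + c v) v)"
    by (simp add: ac_simps)
qed (auto simp: stable_zero stabilization_stable add.commute
    intro: stabilization(2) config_add stable_config)

section \<open>Configurations that divide zero\<close>

text \<open>For stable \<open>c\<close> this amounts to invertibility in the monoid. Phrasing it by
  toppling sequences extends it to unstable configurations, such as a full pile on one
  vertex.\<close>

definition divides_zero :: "('v \<Rightarrow> nat) \<Rightarrow> bool" where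
  "divides_zero c \<longleftrightarrow> (\<exists>d. config G s d \<and> (topples G s)\<^sup>*\<^sup>* (\<lambda>v. c v + d v) (\<lambda>_. 0))"

lemma divides_zero_zero: "divides_zero (\<lambda>_. 0)"
  unfolding divides_zero_def by (rule exI[of _ "\<lambda>_. 0"]) (simp add: config_def)

lemma divides_zero_add:
  assumes "config G s c" "config G s c'" "divides_zero c" "divides_zero c'"
  shows "divides_zero (\<lambda>v. c v + c' v)"
proof -
  obtain d d' where d: "config G s d" "(topples G s)\<^sup>*\<^sup>* (\<lambda>v. c v + d v) (\<lambda>_. 0)"
    and d': "config G s d'" "(topples G s)\<^sup>*\<^sup>* (\<lambda>v. c' v + d' v) (\<lambda>_. 0)"
    using assms by (auto simp: divides_zero_def)
  have "(topples G s)\<^sup>*\<^sup>* (\<lambda>v. (c v + d v) + (c' v + d' v)) (\<lambda>v. 0 + (c' v + d' v))"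
    using topples_rtranclp_add[OF d(2) config_add[OF assms(2) d'(1)]] .
  then have "(topples G s)\<^sup>*\<^sup>* (\<lambda>v. (c v + c' v) + (d v + d' v)) (\<lambda>_. 0)"
    using d'(2) by (simp add: ac_simps)
  then show ?thesis unfolding divides_zero_def using config_add[OF d(1) d'(1)] by blast
qed

lemma divides_zero_topples:
  assumes "topples G s c c'" "divides_zero c'"
  shows "divides_zero c"
  using assms topples_add converse_rtranclp_into_rtranclp unfolding divides_zero_def by metis

text \<open>The complement \<open>c'\<close> is absorbed into the witness.\<close>

lemma divides_zero_summand:
  assumes "config G s c'" "divides_zero (\<lambda>v. c v + c' v)"
  shows "divides_zero c"
  using assms config_add unfolding divides_zero_def by (metis (no_types, lifting) add.assoc ext)

text \<open>Induction on the total number of grains, splitting off one grain at a time.\<close>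

lemma divides_zero_if_grains:
  assumes "config G s c" "\<And>v. 0 < c v \<Longrightarrow> divides_zero (grain v)"
  shows "divides_zero c"
  using assms
proof (induction "\<Sum>v\<in>verts G. c v" arbitrary: c)
  case 0
  then have "c = (\<lambda>_. 0)" by (auto simp: config_def)
  then show ?case by (simp add: divides_zero_zero)
next
  case (Suc n)
  then obtain v where v: "v \<in> verts G" "0 < c v"
    by (metis gr0I sum.neutral nat.distinct(1))
  define c' where "c' = c(v := c v - 1)"
  have c: "c = (\<lambda>w. grain v w + c' w)" using v by (auto simp: c'_def grain_def)
  have "config G s c'" using Suc.prems(1) by (auto simp: c'_def config_def)
  moreover have "config G s (grain v)"
    using Suc.prems(1) v unfolding config_def grain_def by auto
  moreover have "divides_zero c'"
  proof (rule Suc.hyps(1))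
    have "(\<Sum>w\<in>verts G. c w) = (\<Sum>w\<in>verts G. grain v w) + (\<Sum>w\<in>verts G. c' w)"
      by (subst c) (simp add: sum.distrib)
    then show "n = (\<Sum>w\<in>verts G. c' w)" using Suc.hyps(2) v by (simp add: grain_def)
  next
    show "divides_zero (grain w)" if "0 < c' w" for w
      using that Suc.prems(2)[of w] v by (auto simp: c'_def split: if_splits)
  qed fact
  ultimately show ?case using divides_zero_add Suc.prems(2)[OF v(2)] by (subst c) blast
qed

end

section \<open>Absorbing sink: every configuration on \<open>S\<close> divides zero\<close>

locale sandpile_absorbing = sandpile +
  assumes sink: "out_arcs G s = {}"
begin

abbreviation S :: "('a, 'b) pre_digraph" where
  "S \<equiv> S_graph G s (\<lambda>_. 0)"

abbreviation X :: "('a, 'b) pre_digraph" where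
  "X \<equiv> pre_digraph.del_vert G s"

sublocale X: fin_digraph X
  by (rule fin_digraph_del_vert)

lemma verts_S: "verts S = A_set X (\<lambda>_. 0) \<union> {s}"
  by (simp add: S_graph_def S_verts_def Let_def cl_def supp_def)

lemma verts_S_subset: "verts S \<subseteq> verts G"
  using S_verts_subset[of s G] sandpile_graph by (simp add: S_graph_def sandpile_graph_def)

lemma out_degree_S: "v \<in> verts S \<Longrightarrow> out_degree S v = out_degree G v"
  using arcs_S_graph[OF wf_digraph sink]
  by (auto simp: out_degree_def out_arcs_def S_graph_def intro!: arg_cong[of _ _ card])

lemma config_S: "config S s c \<longleftrightarrow> config G s c \<and> (\<forall>v. 0 < c v \<longrightarrow> v \<in> verts S)"
  using verts_S_subset by (auto simp: config_def)

text \<open>Vertices outside \<open>S\<close> are empty, and their out-degree is positive, so they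
  satisfy the stability bound automatically.\<close>

lemma stable_S: "stable S s c \<longleftrightarrow> stable G s c \<and> config S s c"
  using verts_S_subset out_degree_pos
  by (auto simp: stable_def out_degree_S config_S) (metis DiffI gr0I singletonD)

lemma divides_zero_grain:
  assumes "v \<in> verts S - {s}"
  shows "divides_zero (grain v)"
proof -
  let ?A = "A_set X (\<lambda>_. 0)"
  \<comment> \<open>Passing to an out-neighbour is well-founded from \<open>?A\<close>: the relation
    is finite, and a cycle in it would run through an acyclic vertex.\<close>
  define R where "R = {(w, v). v \<rightarrow>\<^bsub>X\<^esub> w \<and> v \<in> ?A}"
  have "finite R"
    by (rule finite_subset[of _ "verts X \<times> verts X"]) (auto simp: R_def dest: X.adj_in_verts)
  moreover have "acyclic R"
  proof (rule acyclicI, intro allI notI)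
    fix v assume v: "(v, v) \<in> R\<^sup>+"
    then have "v \<in> ?A" by (auto simp: R_def dest: tranclD2)
    have "R \<subseteq> (arcs_ends X)\<inverse>" by (auto simp: R_def)
    then have "(v, v) \<in> ((arcs_ends X)\<inverse>)\<^sup>+" using v trancl_mono by blast
    then have "v \<rightarrow>\<^sup>+\<^bsub>X\<^esub> v" by (simp add: trancl_converse)
    then show False
      using \<open>v \<in> ?A\<close> X.acyclic_vertex_not_reachable1 by (auto simp: A_set_def)
  qed
  ultimately have "wf R" by (rule finite_acyclic_wf)
  then show ?thesis
    using assms
  proof (induction v)
    case (less v)
    have v: "v \<in> verts G - {s}" "v \<in> ?A" using less.prems verts_S_subset verts_S by auto
    let ?n = "out_degree G v"
    define c where "c = (\<lambda>w. ?n * grain v w)"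
    have "divides_zero (topple G s v c)"
    proof (rule divides_zero_if_grains)
      fix w assume w: "0 < topple G s v c w"
      then have "w \<in> verts G - {s}" by (auto simp: topple_def split: if_splits)
      moreover from w have "out_arcs G v \<inter> in_arcs G w \<noteq> {}"
        \<comment> \<open>Toppling uses up the pile at \<open>v\<close> exactly, so every grain left
          has come along an arc out of \<open>v\<close>.\<close>
        by (auto simp: topple_def c_def grain_def split: if_splits)
      then obtain a where a: "a \<in> arcs G" "tail G a = v" "head G a = w" by fastforce
      ultimately have "w \<in> verts S - {s}"
        using S_verts_closed[OF wf_digraph sink, of a] less.prems by (simp add: S_graph_def)
      moreover have "a \<in> arcs X" "tail X a = v" "head X a = w"
        using a v \<open>w \<in> verts G - {s}\<close> by (auto simp: del_vert_simps)
      then have "v \<rightarrow>\<^bsub>X\<^esub> w" by (metis X.dominatesI arc_to_ends_def)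
      then have "(w, v) \<in> R" using v by (simp add: R_def)
      ultimately show "divides_zero (grain w)" using less.IH by blast
    qed (rule config_topple)
    moreover have "topples G s c (topple G s v c)"
      using v(1) by (auto simp: topples_def c_def grain_def)
    ultimately have "divides_zero c" by (rule divides_zero_topples[rotated])
    \<comment> \<open>One grain is split off the pile; positivity of the out-degree makes
      \<open>?n - 1\<close> exact.\<close>
    moreover have "c = (\<lambda>w. grain v w + (?n - 1) * grain v w)"
      using out_degree_pos[OF v(1)] by (auto simp: c_def grain_def)
    moreover have "config G s (\<lambda>w. (?n - 1) * grain v w)"
      using v(1) by (auto simp: config_def grain_def)
    ultimately show ?case using divides_zero_summand by metis
  qed
qed

lemma divides_zero_S: "config S s c \<Longrightarrow> divides_zero c"
  using divides_zero_if_grains divides_zero_grain by (metis config_S config_def gr_implies_not0)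

section \<open>Grains at vertices that reach a cycle are never cleared\<close>

text \<open>Keeping \<open>x\<close> fixed makes this an invariant of toppling: either
  \<open>v\<close> is not toppled and keeps its grains, or it passes one to the next vertex on a
  path to \<open>x\<close>.\<close>

lemma topples_charges_reaching_cycle:
  assumes "topples G s c d" "0 < c v" "v \<in> verts X" "v \<rightarrow>\<^sup>*\<^bsub>X\<^esub> x" "x \<rightarrow>\<^sup>+\<^bsub>X\<^esub> x"
  shows "\<exists>w. 0 < d w \<and> w \<in> verts X \<and> w \<rightarrow>\<^sup>*\<^bsub>X\<^esub> x"
proof -
  obtain u where u: "u \<in> verts G - {s}" "d = topple G s u c"
    using assms(1) by (auto simp: topples_def)
  have v: "v \<in> verts G - {s}" using assms(3) by (simp add: del_vert_simps)
  show ?thesis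
  proof (cases "u = v")
    case False
    then have "0 < d v" using v u assms(2) by (simp add: topple_def)
    then show ?thesis using assms by blast
  next
    case True
    \<comment> \<open>Appending the closed path at \<open>x\<close> gives a first step even when
      \<open>v = x\<close>.\<close>
    have "v \<rightarrow>\<^sup>+\<^bsub>X\<^esub> x" using assms(4,5) by (rule X.reachable_reachable1_trans)
    then obtain w where w: "v \<rightarrow>\<^bsub>X\<^esub> w" "w \<rightarrow>\<^sup>*\<^bsub>X\<^esub> x"
      by (metis tranclD X.reachable_conv X.adj_in_verts(2) X.reachable_in_verts(2) assms(4)
          mem_Sigma_iff IntI)
    then have wX: "w \<in> verts X" using X.adj_in_verts by blast
    obtain a where "a \<in> arcs X" "tail X a = v" "head X a = w" using w(1) by auto
    then have "a \<in> out_arcs G v \<inter> in_arcs G w" by (auto simp: del_vert_simps)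
    moreover have "finite (out_arcs G v \<inter> in_arcs G w)" using finite_out_arcs by blast
    ultimately have "0 < card (out_arcs G v \<inter> in_arcs G w)" by (auto simp: card_gt_0_iff)
    then have "0 < d w" using True u wX by (auto simp: topple_def del_vert_simps)
    then show ?thesis using w(2) wX by blast
  qed
qed

lemma config_S_if_topples_zero:
  assumes "config G s c" "(topples G s)\<^sup>*\<^sup>* c (\<lambda>_. 0)"
  shows "config S s c"
  unfolding config_S
proof (intro conjI allI impI, fact assms(1), rule ccontr)
  fix v assume v: "0 < c v" "v \<notin> verts S"
  then have vX: "v \<in> verts X" using assms(1) by (auto simp: config_def del_vert_simps)
  moreover have "v \<notin> A_set X (\<lambda>_. 0)" using v(2) by (simp add: verts_S)
  ultimately obtain x where x: "v \<rightarrow>\<^sup>*\<^bsub>X\<^esub> x" "x \<rightarrow>\<^sup>+\<^bsub>X\<^esub> x"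
    using X.reaches_cycle_if_not_in_A_set by blast
  have "\<exists>w. 0 < d w \<and> w \<in> verts X \<and> w \<rightarrow>\<^sup>*\<^bsub>X\<^esub> x" if "(topples G s)\<^sup>*\<^sup>* c d" for d
    using that
  proof induction
    case base
    then show ?case using v vX x by blast
  next
    case (step d d')
    then show ?case using topples_charges_reaching_cycle x(2) by blast
  qed
  from this[OF assms(2)] show False by simp
qed

section \<open>Units of the monoid and the minimal ideal of \<open>S\<close>\<close>

lemma stable_S_iff_unit: "stable S s c \<longleftrightarrow> c \<in> Units (sandpile_monoid G s)"
proof
  assume c: "stable S s c"
  then have cG: "stable G s c" by (simp add: stable_S)
  obtain d where d: "config G s d" "(topples G s)\<^sup>*\<^sup>* (\<lambda>v. c v + d v) (\<lambda>_. 0)"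
    using divides_zero_S c by (auto simp: divides_zero_def stable_S)
  \<comment> \<open>The witness \<open>d\<close> may be unstable; its stabilization is the inverse
    inside the monoid.\<close>
  let ?d = "stabilization G s d"
  have "stabilization G s (\<lambda>v. ?d v + c v) = stabilization G s (\<lambda>v. d v + c v)"
    using stabilization_add_stabilization d(1) cG stable_config by blast
  also have "\<dots> = (\<lambda>_. 0)"
    using stabilization_unique[OF d(2) stable_zero] by (simp add: add.commute)
  finally show "c \<in> Units (sandpile_monoid G s)"
    using cG stabilization(2)[OF d(1)] unfolding Units_def sandpile_monoid_simps
    by (auto simp: add.commute intro!: bexI[of _ ?d])
next
  assume "c \<in> Units (sandpile_monoid G s)"
  then obtain d where cd: "stable G s c" "stable G s d" "stabilization G s (\<lambda>v. c v + d v) = (\<lambda>_. 0)"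
    by (auto simp: Units_def sandpile_monoid_simps)
  then have "config G s (\<lambda>v. c v + d v)" by (intro config_add stable_config)
  then have "config S s (\<lambda>v. c v + d v)"
    using config_S_if_topples_zero stabilization(1) cd(3) by metis
  \<comment> \<open>A sum of natural numbers vanishes off \<open>S\<close> only if each summand
    does.\<close>
  then show "stable S s c" using cd(1) by (auto simp: stable_S config_def)
qed

text \<open>The stable configurations of \<open>S\<close> form the unit group, with the same
  product, and a group has no ideal other than itself.\<close>

lemma minimal_ideal_S: "sandpile_group S s = Units (sandpile_monoid G s)"
proof -
  let ?M = "sandpile_monoid G s" and ?N = "sandpile_monoid S s"
  interpret M: comm_monoid ?M by (rule comm_monoid_sandpile_monoid)
  have carrier: "carrier ?N = Units ?M"
    using stable_S_iff_unit by (auto simp: sandpile_monoid_def)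
  have mult: "a \<otimes>\<^bsub>?N\<^esub> b = a \<otimes>\<^bsub>?M\<^esub> b" if "a \<in> Units ?M" "b \<in> Units ?M" for a b
  proof -
    have "config S s (\<lambda>v. a v + b v)"
      using that by (auto simp: stable_S_iff_unit[symmetric] stable_S config_def)
    then show ?thesis
      using stabilization_S_graph[OF sandpile_graph sink] by (simp add: sandpile_monoid_def)
  qed
  have ideal: "monoid_ideal ?N (Units ?M)"
    unfolding monoid_ideal_def carrier using mult M.Units_one_closed by fastforce
  have ideal_eq: "I = Units ?M" if I: "monoid_ideal ?N I" for I
  proof -
    obtain x where x: "x \<in> I" "x \<in> Units ?M" using I by (auto simp: monoid_ideal_def carrier)
    have "a \<in> I" if a: "a \<in> Units ?M" for a
    proof -
      \<comment> \<open>This multiplier carries the given element \<open>x\<close> of the ideal to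
        the arbitrary unit \<open>a\<close>.\<close>
      let ?b = "a \<otimes>\<^bsub>?M\<^esub> inv\<^bsub>?M\<^esub> x"
      have b: "?b \<in> Units ?M" using a x by simp
      then have "?b \<otimes>\<^bsub>?N\<^esub> x \<in> I" using I x by (simp add: monoid_ideal_def carrier)
      moreover have "?b \<otimes>\<^bsub>?M\<^esub> x = a" using a x by (simp add: M.m_assoc M.Units_closed)
      ultimately show ?thesis using mult[OF b x(2)] by simp
    qed
    then show ?thesis using I by (auto simp: monoid_ideal_def carrier)
  qed
  show ?thesis
    unfolding sandpile_group_def minimal_ideal_def
    by (rule the_equality) (use ideal ideal_eq in blast)+
qed

end

section \<open>The maximal subgroup at the identity, and the conclusion\<close>

text \<open>Inverses in a subgroup with identity \<open>\<one>\<close> are inverses in the monoid,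
  so \<open>Units G\<close> contains every such subgroup; being the greatest, it is the only maximal
  one.\<close>

lemma (in monoid) maximal_subgroup_one: "maximal_subgroup G \<one> = Units G"
proof -
  have group: "subgroup_at G \<one> (Units G)"
  proof -
    have "group (G\<lparr>carrier := Units G, one := \<one>\<rparr>)"
      by (rule groupI) (auto simp: m_assoc Units_closed intro: Units_l_inv Units_inv_Units)
    then show ?thesis by (auto simp: subgroup_at_def)
  qed
  have sub: "K \<subseteq> Units G" if "subgroup_at G \<one> K" for K
  proof
    fix x assume x: "x \<in> K"
    interpret K: group "G\<lparr>carrier := K, one := \<one>\<rparr>" using that by (simp add: subgroup_at_def)
    have "K \<subseteq> carrier G" using that by (simp add: subgroup_at_def)
    then show "x \<in> Units G"
      using K.l_inv_ex K.r_inv_ex K.Units_eq x unfolding Units_def by fastforce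
  qed
  show ?thesis
    unfolding maximal_subgroup_def
    by (rule the_equality) (use group sub in blast)+
qed

theorem theorem3p5:
  fixes G :: "('v, 'e) pre_digraph" and s :: 'v
  assumes "sandpile_graph G s" and "out_arcs G s = {}"
  shows "(verts (S_graph G s (\<lambda>_. 0)) = {s} \<longrightarrow>
            maximal_subgroup (sandpile_monoid G s) (\<lambda>_. 0) = {\<lambda>_. 0}) \<and>
         (verts (S_graph G s (\<lambda>_. 0)) \<noteq> {s} \<longrightarrow>
            maximal_subgroup (sandpile_monoid G s) (\<lambda>_. 0) = sandpile_group (S_graph G s (\<lambda>_. 0)) s)"
proof -
  interpret sandpile_absorbing G s
    using assms by (auto simp: sandpile_absorbing_def sandpile_def sandpile_absorbing_axioms_def
        sandpile_axioms_def sandpile_graph_def)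
  interpret M: comm_monoid "sandpile_monoid G s" by (rule comm_monoid_sandpile_monoid)
  have units: "maximal_subgroup (sandpile_monoid G s) (\<lambda>_. 0) = Units (sandpile_monoid G s)"
    using M.maximal_subgroup_one by (simp add: sandpile_monoid_simps)
  have "Units (sandpile_monoid G s) = {\<lambda>_. 0}" if "verts S = {s}"
  proof -
    have "c = (\<lambda>_. 0)" if "stable S s c" for c
      using that \<open>verts S = {s}\<close> by (auto simp: stable_def config_def)
    moreover have "(\<lambda>_. 0) \<in> Units (sandpile_monoid G s)"
      using M.Units_one_closed by (simp add: sandpile_monoid_simps)
    ultimately show ?thesis unfolding stable_S_iff_unit by blast
  qed
  then show ?thesis by (simp add: units minimal_ideal_S)
qed

end
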